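(* Let $n\geq 2$ and let $M=(a_{i,j})_{1\leq i,j\leq n}$ be a Steinhaus matrix of size $n$ with associated Steinhaus graph $G$ on vertices $V_1,\ldots,V_n$. Then for all $1\leq i\leq\left\lfloor \frac{n}{2}\right\rfloor$, $$ a_{i,n-i+1} \equiv \sum_{k=0}^{i-1}{\binom{i-1}{k}\deg\left(V_{i+k+1}\right)} \equiv \sum_{k=0}^{i-1}{\binom{i-1}{k}\deg\left(V_{n-i-k}\right)} \pmod{2}, $$ where the entry $a_{i,n-i+1}\in\{0,1\}$ is viewed as an integer.
   Context: A Steinhaus matrix of size $n\geq1$ is a matrix $M=(a_{i,j})_{1\leq i,j\leq n}$ with entries in $\mathbb{F}_2=\{0,1\}$ such that $a_{i,i}=0$ for all $i$, $a_{i,j}=a_{i-1,j-1}+a_{i-1,j}$ (addition in $\mathbb{F}_2$) for all $2\leq i<j\leq n$, and $a_{i,j}=a_{j,i}$ for all $i,j$. The Steinhaus graph associated with $M$ is the simple graph on vertices $V_1,\ldots,V_n$ whose adjacency matrix is $M$ ($V_i$ and $V_j$ are adjacent iff $a_{i,j}=1$). $\deg(V_i)$ denotes the degree of $V_i$, i.e. $\sum_{j=1}^n a_{i,j}$ with entries viewed as integers $0,1$. *)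

theory Defs
  imports
    "HOL-Library.Z2"
    "HOL-Number_Theory.Cong"
    "Graph_Theory.Pair_Digraph"
begin

text \<open>
  The entries of an \<open>n \<times> n\<close> matrix over \<open>\<bbbF>\<^sub>2\<close> are indexed from \<open>1\<close>. Values of \<open>a\<close> outside
  \<open>{1..n} \<times> {1..n}\<close> are irrelevant.
\<close>

definition steinhaus_matrix :: "nat \<Rightarrow> (nat \<Rightarrow> nat \<Rightarrow> bit) \<Rightarrow> bool" where
  "steinhaus_matrix n a \<longleftrightarrow>
     (\<forall>i\<in>{1..n}. a i i = 0) \<and>
     (\<forall>i j. 2 \<le> i \<and> i < j \<and> j \<le> n \<longrightarrow> a i j = a (i - 1) (j - 1) + a (i - 1) j) \<and>
     (\<forall>i\<in>{1..n}. \<forall>j\<in>{1..n}. a i j = a j i)"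

text \<open>
  A simple graph is a finite symmetric loop-free digraph (locale \<open>pair_graph\<close>): an edge
  between \<open>u\<close> and \<open>v\<close> is represented by the two arcs \<open>(u, v)\<close> and \<open>(v, u)\<close>, so the degree of
  a vertex is its out-degree. The vertex \<open>V\<^sub>i\<close> is the number \<open>i\<close>.
\<close>

definition steinhaus_graph :: "nat \<Rightarrow> (nat \<Rightarrow> nat \<Rightarrow> bit) \<Rightarrow> nat pair_pre_digraph" where
  "steinhaus_graph n a =
     \<lparr> pverts = {1..n}, parcs = {(i, j). i \<in> {1..n} \<and> j \<in> {1..n} \<and> a i j = 1} \<rparr>"

abbreviation deg :: "nat pair_pre_digraph \<Rightarrow> nat \<Rightarrow> nat" where
  "deg G v \<equiv> out_degree (with_proj G) v"

lemma pair_graph_steinhaus_graph: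
  assumes "steinhaus_matrix n a"
  shows "pair_graph (steinhaus_graph n a)"
proof
  have diag: "a i i = 0" if "i \<in> {1..n}" for i
    using assms that by (simp only: steinhaus_matrix_def)
  have sym: "a i j = a j i" if "i \<in> {1..n}" "j \<in> {1..n}" for i j
    using assms that unfolding steinhaus_matrix_def by blast
  show "finite (parcs (steinhaus_graph n a))"
    by (rule finite_subset[of _ "{1..n} \<times> {1..n}"]) (auto simp: steinhaus_graph_def)
  show "symmetric (with_proj (steinhaus_graph n a))"
    using sym by (auto simp: symmetric_def sym_def steinhaus_graph_def)
  show "fst e \<noteq> snd e" if "e \<in> parcs (steinhaus_graph n a)" for e
    using that diag by (auto simp: steinhaus_graph_def)
qed (auto simp: steinhaus_graph_def)

lemma deg_steinhaus_graph:
  assumes "i \<in> {1..n}"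
  shows "deg (steinhaus_graph n a) i = (\<Sum>j = 1..n. of_bool (a i j = 1))"
proof -
  have "out_arcs (with_proj (steinhaus_graph n a)) i = Pair i ` {j \<in> {1..n}. a i j = 1}"
    using assms by (auto simp: out_arcs_def steinhaus_graph_def)
  then have "deg (steinhaus_graph n a) i = card {j \<in> {1..n}. a i j = 1}"
    by (simp add: out_degree_def card_image inj_on_def)
  also have "\<dots> = (\<Sum>j = 1..n. of_bool (a i j = 1))"
    by (simp add: sum.If_cases of_bool_def Int_def)
  finally show ?thesis .
qed

end

theory Submission
  imports Defs
begin

text \<open>
  Extend the upper triangle of \<open>a\<close> by a row \<open>0\<close> and a column \<open>n + 1\<close> so that the local rule
  \<open>b (i + 1) (j + 1) = b i j + b i (j + 1)\<close> persists. Telescoping along column and row \<open>j\<close> gives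
  \<open>deg V\<^sub>j \<equiv> b (j - 1) (j + 1) + b 1 (j + 1) + b (j - 1) n\<close>, uniformly for \<open>1 \<le> j \<le> n\<close>. Read in its
  three directions, the local rule is Pascal's rule along a diagonal, a row and a column
  respectively, so each of the three terms has a closed form when summed against binomial
  coefficients. For both sums in the theorem two of these closed forms cancel, and the third is
  \<open>a i (n - i + 1)\<close>.
\<close>

text \<open>These simplification rules would rewrite ring terms over \<open>bit\<close> into \<open>XOR\<close> and \<open>AND\<close>.\<close>

declare add_bit_eq_xor [simp del] mult_bit_eq_and [simp del]

lemma add_self_bit [simp]: "x + x = (0 :: bit)" "x + (x + y) = (y :: bit)"
  by (cases x; cases y; simp)+

text \<open>Generating everything from row 0 makes the local rule hold with no exception at the
  diagonal or beyond column \<open>n\<close>. The truncated \<open>j - 1\<close> matters only in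
  column 0.\<close>

primrec pascal_array :: "(nat \<Rightarrow> bit) \<Rightarrow> nat \<Rightarrow> nat \<Rightarrow> bit" where
  "pascal_array x 0 j = x j"
| "pascal_array x (Suc i) j = pascal_array x i (j - 1) + pascal_array x i j"

text \<open>Row \<open>0\<close> is an antiderivative of row \<open>1\<close>; the entry \<open>a 1 (n + 1)\<close> it also uses is arbitrary.\<close>

definition steinhaus_extension :: "(nat \<Rightarrow> nat \<Rightarrow> bit) \<Rightarrow> nat \<Rightarrow> nat \<Rightarrow> bit" where
  "steinhaus_extension a = pascal_array (\<lambda>j. \<Sum>l = 2..j. a 1 l)"

lemma steinhaus_extension_Suc_Suc:
  "steinhaus_extension a (Suc i) (Suc j) =
     steinhaus_extension a i j + steinhaus_extension a i (Suc j)"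
  by (simp add: steinhaus_extension_def)

lemma steinhaus_extension_eq:
  assumes "steinhaus_matrix n a" "1 \<le> i" "i < j" "j \<le> n"
  shows "steinhaus_extension a i j = a i j"
  using assms(2-)
proof (induction i arbitrary: j rule: dec_induct)
  case base
  \<comment> \<open>For \<open>j\<close> at least 2, the two partial sums differ by the last summand
    \<open>a 1 j\<close>.\<close>
  obtain l where "j = Suc (Suc l)"
    using base.prems(1) by (auto simp: less_iff_Suc_add)
  then show ?case
    by (simp add: steinhaus_extension_def)
next
  case (step i)
  from step.prems obtain l where l: "j = Suc l" "i < l" "l < n"
    by (cases j) auto
  moreover have "a (Suc i) (Suc l) = a i l + a i (Suc l)"
  proof -
    have "\<forall>i j. 2 \<le> i \<and> i < j \<and> j \<le> n \<longrightarrow> a i j = a (i - 1) (j - 1) + a (i - 1) j"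
      using assms(1) unfolding steinhaus_matrix_def by (elim conjE)
    from this[rule_format, of "Suc i" "Suc l"] show ?thesis
      using l step.hyps by simp
  qed
  ultimately show ?case
    using step.IH[of l] step.IH[of "Suc l"] by (simp add: steinhaus_extension_Suc_Suc)
qed

text \<open>With \<open>E\<close> the shift in \<open>t\<close>, each step in \<open>l\<close>
  applies \<open>1 + E\<close>, so \<open>F m\<close> is the binomial expansion of
  \<open>(1 + E)^m\<close> applied to \<open>F 0\<close>. The bound \<open>l < m\<close> keeps a
  descending index \<open>n - l\<close> clear of truncation.\<close>

lemma binomial_sum_of_pascal_rule:
  fixes F :: "nat \<Rightarrow> nat \<Rightarrow> 'a::comm_semiring_1"
  assumes "\<And>l t. l < m \<Longrightarrow> F (Suc l) t = F l t + F l (Suc t)"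
  shows "(\<Sum>k\<le>m. of_nat (m choose k) * F 0 (t + k)) = F m t"
  using assms
proof (induction m arbitrary: t)
  case (Suc m)
  have "(\<Sum>k\<le>Suc m. of_nat (Suc m choose k) * F 0 (t + k)) =
      F 0 t + (\<Sum>k\<le>m. of_nat (m choose Suc k) * F 0 (t + Suc k))
        + (\<Sum>k\<le>m. of_nat (m choose k) * F 0 (Suc t + k))"
    by (subst sum.atMost_Suc_shift) (simp add: algebra_simps sum.distrib)
  also have "F 0 t + (\<Sum>k\<le>m. of_nat (m choose Suc k) * F 0 (t + Suc k)) =
      (\<Sum>k\<le>Suc m. of_nat (m choose k) * F 0 (t + k))"
    by (subst sum.atMost_Suc_shift) simp
  also have "\<dots> = (\<Sum>k\<le>m. of_nat (m choose k) * F 0 (t + k))"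
    by (simp add: binomial_eq_0)
  finally show ?case
    using Suc.IH[of t] Suc.IH[of "Suc t"] Suc.prems[of m t] Suc.prems by simp
qed simp

text \<open>In characteristic 2 the local rule makes each entry the difference of two vertical
  neighbours in the next column.\<close>

lemma sum_column_telescope:
  assumes "1 \<le> q"
  shows "(\<Sum>l = 1..<q. steinhaus_extension a l j) =
    steinhaus_extension a 1 (Suc j) + steinhaus_extension a q (Suc j)"
  using assms
  by (induction q rule: dec_induct) (simp_all add: steinhaus_extension_Suc_Suc ac_simps)

lemma sum_row_telescope:
  assumes "j \<le> q"
  shows "(\<Sum>l \<in> {j<..q}. steinhaus_extension a (Suc i) l) =
    steinhaus_extension a i j + steinhaus_extension a i q"
  using assms
proof (induction q rule: dec_induct)
  case (step q)
  then have "{j<..Suc q} = insert (Suc q) {j<..q}"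
    by auto
  with step show ?case
    by (simp add: steinhaus_extension_Suc_Suc ac_simps)
qed simp

lemma of_bool_eq_one_bit: "of_bool (x = 1) = (x :: bit)"
  by (cases x) simp_all

lemma of_nat_deg_steinhaus_graph:
  assumes "steinhaus_matrix n a" "Suc p \<le> n"
  shows "of_nat (deg (steinhaus_graph n a) (Suc p)) =
    steinhaus_extension a p (p + 2) + steinhaus_extension a 1 (p + 2) + steinhaus_extension a p n"
proof -
  let ?b = "steinhaus_extension a" and ?j = "Suc p"
  have "?j \<in> {1..n}"
    using assms(2) by simp
  then have "of_nat (deg (steinhaus_graph n a) ?j) = (\<Sum>l = 1..n. a ?j l)"
    by (simp only: deg_steinhaus_graph of_nat_sum of_nat_of_bool of_bool_eq_one_bit)
  also have "{1..n} = {1..<?j} \<union> ({?j<..n} \<union> {?j})"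
    using assms(2) by auto
  also have "(\<Sum>l \<in> \<dots>. a ?j l) =
      (\<Sum>l = 1..<?j. a ?j l) + ((\<Sum>l \<in> {?j<..n}. a ?j l) + a ?j ?j)"
    by (subst sum.union_disjoint, simp, simp, fastforce)+ (simp del: sum.op_ivl_Suc)
  also have "a ?j ?j = 0"
    using assms by (simp add: steinhaus_matrix_def)
  \<comment> \<open>Symmetry turns the row left of the diagonal into the column above it, where
    \<open>?b\<close> agrees with \<open>a\<close>.\<close>
  also have "(\<Sum>l = 1..<?j. a ?j l) = (\<Sum>l = 1..<?j. ?b l ?j)"
  proof (rule sum.cong)
    fix l assume "l \<in> {1..<?j}"
    then have "a ?j l = a l ?j"
      using assms unfolding steinhaus_matrix_def by simp
    with \<open>l \<in> {1..<?j}\<close> show "a ?j l = ?b l ?j"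
      using assms by (simp add: steinhaus_extension_eq)
  qed simp
  also have "\<dots> = ?b 1 (Suc ?j) + ?b ?j (Suc ?j)"
    by (rule sum_column_telescope) simp
  also have "(\<Sum>l \<in> {?j<..n}. a ?j l) = (\<Sum>l \<in> {?j<..n}. ?b ?j l)"
    using assms by (intro sum.cong) (simp_all add: steinhaus_extension_eq)
  also have "\<dots> = ?b p ?j + ?b p n"
    using assms(2) by (rule sum_row_telescope)
  \<comment> \<open>The local rule merges \<open>?b ?j (Suc ?j) + ?b p ?j\<close> into
    \<open>?b p (p + 2)\<close>.\<close>
  finally show ?thesis
    by (simp add: steinhaus_extension_Suc_Suc[of a p] ac_simps)
qed

lemma binomial_sum_deg_steinhaus_graph:
  assumes "steinhaus_matrix n a" "Suc (p + m) \<le> n"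
  shows "(\<Sum>k\<le>m. of_nat (m choose k) * of_nat (deg (steinhaus_graph n a) (Suc (p + k)))) =
    steinhaus_extension a p (p + 2 + m) + steinhaus_extension a (Suc m) (p + 2 + m)
      + steinhaus_extension a p (n - m)"
proof -
  let ?b = "steinhaus_extension a"
  have "(\<Sum>k\<le>m. of_nat (m choose k) * of_nat (deg (steinhaus_graph n a) (Suc (p + k)))) =
      (\<Sum>k\<le>m. of_nat (m choose k) * ?b (p + k) (p + k + 2))
      + (\<Sum>k\<le>m. of_nat (m choose k) * ?b 1 (p + k + 2))
      + (\<Sum>k\<le>m. of_nat (m choose k) * ?b (p + k) n)"
    using assms by (simp add: of_nat_deg_steinhaus_graph distrib_left sum.distrib)
  \<comment> \<open>Diagonal direction: the local rule solved for its upper right entry.\<close>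
  also have "(\<Sum>k\<le>m. of_nat (m choose k) * ?b (p + k) (p + k + 2)) = ?b p (p + 2 + m)"
    using binomial_sum_of_pascal_rule[of m "\<lambda>l t. ?b t (t + 2 + l)" p]
    by (simp add: steinhaus_extension_Suc_Suc)
  \<comment> \<open>Row direction: the column moves right with \<open>l\<close>, since the rule
    looks up and to the left.\<close>
  also have "(\<Sum>k\<le>m. of_nat (m choose k) * ?b 1 (p + k + 2)) = ?b (Suc m) (p + 2 + m)"
    using binomial_sum_of_pascal_rule[of m "\<lambda>l t. ?b (Suc l) (t + 2 + l)" p]
    by (simp add: steinhaus_extension_Suc_Suc)
  also have "(\<Sum>k\<le>m. of_nat (m choose k) * ?b (p + k) n) = ?b p (n - m)"
  proof -
    \<comment> \<open>Column direction: the local rule solved for its upper left entry.\<close>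
    have "?b t (n - Suc l) = ?b t (n - l) + ?b (Suc t) (n - l)" if "l < m" for l t
    proof -
      have "n - l = Suc (n - Suc l)"
        using that assms(2) by simp
      then show ?thesis
        by (simp add: steinhaus_extension_Suc_Suc add.left_commute)
    qed
    then show ?thesis
      using binomial_sum_of_pascal_rule[of m "\<lambda>l t. ?b t (n - l)" p] by simp
  qed
  finally show ?thesis .
qed

lemma cong_2_iff_of_nat_bit: "[x = y] (mod 2) \<longleftrightarrow> (of_nat x :: bit) = of_nat y"
proof -
  have "of_nat z = (of_bool (odd z) :: bit)" for z
    by (induction z) simp_all
  then show ?thesis
    by (simp add: cong_def parity_cases mod_2_eq_odd)
qed

theorem theorem2:
  fixes n i :: nat and a :: "nat \<Rightarrow> nat \<Rightarrow> bit"
  assumes "n \<ge> 2"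
    and "steinhaus_matrix n a"
    and "1 \<le> i" and "i \<le> n div 2"
  shows "[of_bool (a i (n - i + 1) = 1) =
            (\<Sum>k = 0..i - 1. (i - 1 choose k) * deg (steinhaus_graph n a) (i + k + 1))] (mod 2) \<and>
         [(\<Sum>k = 0..i - 1. (i - 1 choose k) * deg (steinhaus_graph n a) (i + k + 1)) =
            (\<Sum>k = 0..i - 1. (i - 1 choose k) * deg (steinhaus_graph n a) (n - i - k))] (mod 2)"
proof -
  let ?b = "steinhaus_extension a" and ?d = "deg (steinhaus_graph n a)"
  obtain m where m: "i = Suc m"
    using assms(3) by (cases i) auto
  \<comment> \<open>Chosen so that the second sum runs over the degrees of vertices
    \<open>q + 1\<close> to \<open>q + i\<close>.\<close>
  define q where "q = n - 2 * i"
  have n: "n = q + 2 * m + 2"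
    using assms(4) m unfolding q_def by simp
  have entry: "a i (n - i + 1) = ?b i (n - m)"
    using steinhaus_extension_eq[OF assms(2), of i "n - m"] by (simp add: m n)
  have "of_nat (\<Sum>k = 0..i - 1. (i - 1 choose k) * ?d (i + k + 1)) =
      (\<Sum>k\<le>m. of_nat (m choose k) * of_nat (?d (Suc (Suc m + k))) :: bit)"
    by (simp add: m atMost_atLeast0)
  \<comment> \<open>With \<open>p = i\<close> the diagonal and row closed forms coincide and
    cancel.\<close>
  also have "\<dots> = ?b (Suc m) (Suc m + 2 + m) + ?b (Suc m) (Suc m + 2 + m) + ?b (Suc m) (n - m)"
    using n by (intro binomial_sum_deg_steinhaus_graph[OF assms(2)]) simp
  finally have low: "of_nat (\<Sum>k = 0..i - 1. (i - 1 choose k) * ?d (i + k + 1)) = a i (n - i + 1)"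
    unfolding entry by (simp add: m)
  \<comment> \<open>Reversing the order makes the vertices ascend; the binomial weights are
    symmetric.\<close>
  have "(\<Sum>k = 0..i - 1. (i - 1 choose k) * ?d (n - i - k)) =
      (\<Sum>k\<le>m. (m choose (m - k)) * ?d (n - i - (m - k)))"
    by (subst sum.atLeastAtMost_rev) (simp add: m atMost_atLeast0)
  also have "\<dots> = (\<Sum>k\<le>m. (m choose k) * ?d (Suc (q + k)))"
    by (intro sum.cong) (auto simp: m n binomial_symmetric[symmetric] intro!: arg_cong[of _ _ ?d])
  finally have "of_nat (\<Sum>k = 0..i - 1. (i - 1 choose k) * ?d (n - i - k)) =
      (\<Sum>k\<le>m. of_nat (m choose k) * of_nat (?d (Suc (q + k))) :: bit)"
    by (simp)
  also have "\<dots> = ?b q (q + 2 + m) + ?b (Suc m) (q + 2 + m) + ?b q (n - m)"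
    using n by (intro binomial_sum_deg_steinhaus_graph[OF assms(2)]) simp
  \<comment> \<open>Here the diagonal and column closed forms coincide, leaving the row one.\<close>
  also have "n - m = q + 2 + m"
    using n by simp
  finally have high: "of_nat (\<Sum>k = 0..i - 1. (i - 1 choose k) * ?d (n - i - k)) = a i (n - i + 1)"
    unfolding entry using n by (simp add: m ac_simps)
  show ?thesis
    unfolding cong_2_iff_of_nat_bit low high of_nat_of_bool of_bool_eq_one_bit by simp
qed

end
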